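(* Let a prior module with parameters $\phi$ output, for each condition $y$, a mean $\mu_\phi(y)$ and a variance $\sigma_\phi^2(y)>0$. Assuming a Gaussian likelihood, let the training objective be the negative log-likelihood (NLL) $$\mathcal{L}=\mathbb{E}_{x,y}\left[\frac{\|x-\mu_\phi(y)\|^2}{2\sigma_\phi^2(y)}+\frac12\log\sigma_\phi^2(y)\right].$$ Under this NLL objective, the gradient of the mean prediction is attenuated by the inverse variance: $$\nabla_{\mu_\phi}\mathcal{L}=-\frac{x-\mu_\phi(y)}{\sigma_\phi^2(y)}.$$ Therefore, large predictive uncertainty downweights the contribution of hard or noisy examples.
   Context: Here $x$ is a data sample, $y$ is its condition, and $\mathbb{E}_{x,y}$ is the expectation over data pairs $(x,y)$. $\|\cdot\|$ is the Euclidean norm. $\mu_\phi(y)$ is the module's prediction of the mean of $x$ given $y$, and $\sigma_\phi^2(y)$ is its predicted variance (predictive uncertainty). $\nabla_{\mu_\phi}$ denotes differentiation with respect to the mean prediction $\mu_\phi(y)$. *)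

theory Defs
  imports "HOL-Probability.Probability"
begin

definition nll_sample :: "'x::euclidean_space \<Rightarrow> 'x \<Rightarrow> real \<Rightarrow> real" where
  "nll_sample x m v = (norm (x - m))\<^sup>2 / (2 * v) + ln v / 2"

text \<open>Up to terms that do not involve the mean, \<^const>\<open>nll_sample\<close> is the negative
  log-likelihood of the isotropic Gaussian with mean \<open>m\<close> and covariance \<open>v\<close> times the identity.
  In dimension one the extra term is the constant \<open>ln (2 * pi) / 2\<close>; in higher dimension the
  weight \<open>1/2\<close> of \<open>ln v\<close> is the convention of the objective itself.\<close>

lemma nll_sample_gaussian:
  fixes x m :: "'x::euclidean_space"
  assumes "v > 0"
  shows "- ln (\<Prod>b\<in>Basis. normal_density (m \<bullet> b) (sqrt v) (x \<bullet> b)) =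
    nll_sample x m v + (real DIM('x) - 1) / 2 * ln v + real DIM('x) / 2 * ln (2 * pi)"
proof -
  have one: "ln (normal_density (m \<bullet> b) (sqrt v) (x \<bullet> b)) =
      - ((x - m) \<bullet> b)\<^sup>2 / (2 * v) - ln v / 2 - ln (2 * pi) / 2" for b
    using assms by (simp add: normal_density_def ln_mult ln_div ln_sqrt inner_diff_left field_simps)
  have "ln (\<Prod>b\<in>Basis. normal_density (m \<bullet> b) (sqrt v) (x \<bullet> b)) =
      (\<Sum>b\<in>Basis. ln (normal_density (m \<bullet> b) (sqrt v) (x \<bullet> b)))"
    using assms by (intro ln_prod) (simp_all add: normal_density_pos less_imp_neq[symmetric])
  also have "\<dots> = - (\<Sum>b\<in>Basis. ((x - m) \<bullet> b)\<^sup>2) / (2 * v)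
      - real DIM('x) * (ln v / 2) - real DIM('x) * (ln (2 * pi) / 2)"
    unfolding one by (simp add: sum_subtractf sum_divide_distrib sum_negf)
  also have "(\<Sum>b\<in>Basis. ((x - m) \<bullet> b)\<^sup>2) = (norm (x - m))\<^sup>2"
    unfolding power2_norm_eq_inner euclidean_inner[of "x - m" "x - m"]
    by (simp add: power2_eq_square)
  finally show ?thesis
    by (simp add: nll_sample_def field_simps)
qed

definition nll_integrand ::
  "('y \<Rightarrow> 'x::euclidean_space) \<Rightarrow> ('y \<Rightarrow> real) \<Rightarrow> 'x \<times> 'y \<Rightarrow> real" where
  "nll_integrand m v = (\<lambda>(x, y). nll_sample x (m y) (v y))"

definition nll ::
  "('x::euclidean_space \<times> 'y) measure \<Rightarrow> ('y \<Rightarrow> 'x) \<Rightarrow> ('y \<Rightarrow> real) \<Rightarrow> real" where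
  "nll P m v = (\<integral>z. nll_integrand m v z \<partial>P)"

definition grad :: "('a::real_inner \<Rightarrow> real) \<Rightarrow> 'a \<Rightarrow> 'a" where
  "grad f a = (THE D. GDERIV f a :> D)"

text \<open>\<open>G\<close> represents the derivative of the expected loss with respect to the mean prediction,
  the variance prediction being held fixed: the derivative along every perturbation \<open>h\<close> of the
  function \<open>m\<close> is the \<open>L\<^sup>2(P)\<close> pairing of \<open>G\<close> with \<open>h\<close>. Since the Bochner integral is \<open>0\<close> for
  non-integrable functions, only perturbations along which the loss is a genuine expectation
  near \<open>m\<close> are considered, and integrability of the pairing is part of the claim. The field \<open>G\<close> is
  a function of the whole sample \<open>(x, y)\<close>, and is determined by this only up to its conditional
  expectation given \<open>y\<close>.\<close>

definition nll_mean_gradient ::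
  "('x::euclidean_space \<times> 'y) measure \<Rightarrow> ('y \<Rightarrow> 'x) \<Rightarrow> ('y \<Rightarrow> real) \<Rightarrow> ('x \<Rightarrow> 'y \<Rightarrow> 'x) \<Rightarrow> bool"
where
  "nll_mean_gradient P m v G \<longleftrightarrow>
    (\<forall>h :: 'y \<Rightarrow> 'x.
      (\<forall>\<^sub>F t in nhds (0::real). integrable P (nll_integrand (\<lambda>y. m y + t *\<^sub>R h y) v)) \<longrightarrow>
      integrable P (\<lambda>(x, y). G x y \<bullet> h y) \<and>
      ((\<lambda>t. nll P (\<lambda>y. m y + t *\<^sub>R h y) v) has_real_derivative
        (\<integral>(x, y). G x y \<bullet> h y \<partial>P)) (at 0))"

end

theory Submission
  imports Defs
begin

text \<open>Along a line \<open>m + t h\<close> of mean predictions the loss integrand is a quadratic polynomial in \<open>t\<close>.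
  Integrability at \<open>t = 0\<close> and at \<open>t = s, -s\<close> for a single \<open>s > 0\<close> makes its coefficients
  integrable, since they are the corresponding finite differences. The expected loss is then itself
  a quadratic polynomial in \<open>t\<close>, so no dominated convergence is needed to differentiate it.\<close>

text \<open>Frechet derivatives are unique and the inner product separates vectors, so the definite
  description in \<open>grad\<close> denotes any gradient that is exhibited.\<close>

lemma GDERIV_imp_grad:
  assumes "GDERIV f a :> D"
  shows "grad f a = D"
  unfolding grad_def
proof (rule the_equality)
  show "GDERIV f a :> D" by (rule assms)
next
  fix E assume "GDERIV f a :> E"
  with assms have "(\<lambda>h. inner h E) = (\<lambda>h. inner h D)"
    unfolding gderiv_def by (blast intro: has_derivative_unique)
  then have "inner h E = inner h D" for h
    by (rule fun_cong)
  \<comment> \<open>Take \<open>h = E - D\<close>.\<close>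
  then have "inner (E - D) (E - D) = 0"
    by (simp add: inner_diff_right)
  then show "E = D"
    by simp
qed

text \<open>The unweighted squared error is the reference against which attenuation by the inverse
  variance is measured.\<close>

lemma GDERIV_half_norm_square:
  fixes x m :: "'x::real_inner"
  shows "GDERIV (\<lambda>m. (norm (x - m))\<^sup>2 / 2) m :> - (x - m)"
  unfolding gderiv_def power2_norm_eq_inner
  by (rule derivative_eq_intros refl | simp add: fun_eq_iff inner_diff inner_commute)+

text \<open>At \<open>v = 0\<close> division by \<open>0\<close> makes the loss constant in the mean and the gradient \<open>0\<close>.\<close>

lemma GDERIV_nll_sample:
  "GDERIV (\<lambda>m. nll_sample x m v) m :> - ((x - m) /\<^sub>R v)"
proof -
  \<comment> \<open>With the variance as a constant factor \<open>inverse v\<close>, no case split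
    on \<open>v = 0\<close> arises.\<close>
  have "((\<lambda>m. (norm (x - m))\<^sup>2 / 2 * inverse v + ln v / 2) has_derivative
      (\<lambda>h. inner h (- (x - m)) * inverse v)) (at m)"
    by (rule has_derivative_add_const
        [OF has_derivative_mult_left[OF GDERIV_half_norm_square[unfolded gderiv_def]]])
  moreover have "nll_sample x n v = (norm (x - n))\<^sup>2 / 2 * inverse v + ln v / 2" for n
    unfolding nll_sample_def divide_inverse inverse_mult_distrib by (simp only: mult.assoc)
  ultimately show ?thesis
    unfolding gderiv_def inner_minus_right inner_scaleR_right mult_minus_left
      mult.commute[of _ "inverse v"]
    by simp
qed

lemmas grad_nll_sample = GDERIV_imp_grad[OF GDERIV_nll_sample]

text \<open>Both strict comparisons of gradient norms reduce to comparing these quotients.\<close>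

lemma norm_grad_nll_sample:
  assumes "v > 0"
  shows "norm (grad (\<lambda>m. nll_sample x m v) m) = norm (x - m) / v"
  using assms by (simp add: grad_nll_sample divide_inverse mult.commute norm_minus_commute)

lemma tendsto_grad_nll_sample:
  "((\<lambda>v. grad (\<lambda>m. nll_sample x m v) m) \<longlongrightarrow> 0) at_top"
proof -
  have "((\<lambda>v. - (inverse v *\<^sub>R (x - m))) \<longlongrightarrow> - (0 *\<^sub>R (x - m))) at_top"
    by (intro tendsto_intros tendsto_inverse_0_at_top filterlim_ident)
  then show ?thesis
    by (simp add: grad_nll_sample)
qed

text \<open>Expanding the square gives an exact second-order expansion in \<open>t\<close>, whose
  linear coefficient is the pairing of the claimed gradient with \<open>h\<close>. If
  \<open>v y = 0\<close>, all the quotients vanish and the identity persists.\<close>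

lemma nll_integrand_line:
  "nll_integrand (\<lambda>y. m y + t *\<^sub>R h y) v (x, y) =
    nll_integrand m v (x, y) + t * (- ((x - m y) /\<^sub>R v y) \<bullet> h y)
      + t\<^sup>2 * ((norm (h y))\<^sup>2 / (2 * v y))"
proof -
  have "(norm (x - (m y + t *\<^sub>R h y)))\<^sup>2 =
      (norm (x - m y))\<^sup>2 - 2 * t * ((x - m y) \<bullet> h y) + t\<^sup>2 * (norm (h y))\<^sup>2"
    unfolding power2_norm_eq_inner
    by (simp add: inner_diff inner_add inner_commute power2_eq_square algebra_simps)
  moreover have "- ((x - m y) /\<^sub>R v y) \<bullet> h y = - ((x - m y) \<bullet> h y) / v y"
    by (simp add: divide_inverse)
  ultimately show ?thesis
    by (simp add: nll_integrand_def nll_sample_def add_divide_distrib diff_divide_distrib)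
qed

lemma nll_mean_gradient_residual:
  "nll_mean_gradient P m v (\<lambda>x y. - ((x - m y) /\<^sub>R v y))"
  unfolding nll_mean_gradient_def
proof (intro allI impI)
  fix h :: "'b \<Rightarrow> 'a"
  define f where "f t = nll_integrand (\<lambda>y. m y + t *\<^sub>R h y) v" for t
  define b where "b = (\<lambda>(x, y). - ((x - m y) /\<^sub>R v y) \<bullet> h y)"
  define c where "c = (\<lambda>(x :: 'a, y). (norm (h y))\<^sup>2 / (2 * v y))"
  assume "\<forall>\<^sub>F t in nhds (0::real). integrable P (nll_integrand (\<lambda>y. m y + t *\<^sub>R h y) v)"
  then obtain e where e: "e > 0" "\<And>t. dist t 0 < e \<Longrightarrow> integrable P (f t)"
    unfolding eventually_nhds_metric f_def by blast
  define s where "s = e / 2"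
  have s: "s > 0" "integrable P (f 0)" "integrable P (f s)" "integrable P (f (- s))"
    using e by (auto simp: s_def)
  have f: "f t z = f 0 z + t * b z + t\<^sup>2 * c z" for t z
    by (cases z) (simp add: f_def b_def c_def nll_integrand_line)
  \<comment> \<open>The central difference cancels the even terms.\<close>
  have "b = (\<lambda>z. (f s z - f (- s) z) / (2 * s))"
    unfolding f[of s] f[of "- s"] using s(1) by simp
  then have b: "integrable P b"
    using s by simp
  \<comment> \<open>The second difference cancels the constant and linear terms.\<close>
  have "c = (\<lambda>z. (f s z + f (- s) z - 2 * f 0 z) / (2 * s\<^sup>2))"
    unfolding f[of s] f[of "- s"] using s(1) by simp
  then have c: "integrable P c"
    using s by simp
  have "nll P (\<lambda>y. m y + t *\<^sub>R h y) v =
      integral\<^sup>L P (f 0) + t * integral\<^sup>L P b + t\<^sup>2 * integral\<^sup>L P c" for t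
  proof -
    have "nll P (\<lambda>y. m y + t *\<^sub>R h y) v = (\<integral>z. f 0 z + t * b z + t\<^sup>2 * c z \<partial>P)"
      by (simp only: nll_def f_def[symmetric] f[of t, symmetric])
    \<comment> \<open>Integrability of all three coefficients lets the integral split
      termwise.\<close>
    then show ?thesis
      using s b c by simp
  qed
  then have "((\<lambda>t. nll P (\<lambda>y. m y + t *\<^sub>R h y) v) has_real_derivative integral\<^sup>L P b) (at 0)"
    by (auto intro!: derivative_eq_intros)
  with b show "integrable P (\<lambda>(x, y). - ((x - m y) /\<^sub>R v y) \<bullet> h y) \<and>
      ((\<lambda>t. nll P (\<lambda>y. m y + t *\<^sub>R h y) v) has_real_derivative
        (\<integral>(x, y). - ((x - m y) /\<^sub>R v y) \<bullet> h y \<partial>P)) (at 0)"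
    by (simp add: b_def)
qed

theorem theorem2:
  fixes P :: "('x::euclidean_space \<times> 'y) measure"
    and mu :: "'p \<Rightarrow> 'y \<Rightarrow> 'x"
    and sigma2 :: "'p \<Rightarrow> 'y \<Rightarrow> real"
    and phi :: 'p
  assumes "prob_space P"
    and "\<And>\<phi> y. sigma2 \<phi> y > 0"
  shows
    "nll_mean_gradient P (mu phi) (sigma2 phi) (\<lambda>x y. - ((x - mu phi y) /\<^sub>R sigma2 phi y))
   \<and> (\<forall>x y. GDERIV (\<lambda>m. nll_sample x m (sigma2 phi y)) (mu phi y) :>
        - ((x - mu phi y) /\<^sub>R sigma2 phi y))
   \<and> (\<forall>x y. grad (\<lambda>m. nll_sample x m (sigma2 phi y)) (mu phi y) =
        grad (\<lambda>m. (norm (x - m))\<^sup>2 / 2) (mu phi y) /\<^sub>R sigma2 phi y)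
   \<and> (\<forall>x y x' y'.
        norm (x - mu phi y) = norm (x' - mu phi y') \<and> x \<noteq> mu phi y \<and>
        sigma2 phi y < sigma2 phi y' \<longrightarrow>
        norm (grad (\<lambda>m. nll_sample x' m (sigma2 phi y')) (mu phi y')) <
        norm (grad (\<lambda>m. nll_sample x m (sigma2 phi y)) (mu phi y)))
   \<and> (\<forall>x y. x \<noteq> mu phi y \<longrightarrow>
        strict_antimono_on {0<..} (\<lambda>v. norm (grad (\<lambda>m. nll_sample x m v) (mu phi y))))
   \<and> (\<forall>x y. ((\<lambda>v. grad (\<lambda>m. nll_sample x m v) (mu phi y)) \<longlongrightarrow> 0) at_top)"
proof (intro conjI allI impI)
  note pos = assms(2)
  show "nll_mean_gradient P (mu phi) (sigma2 phi) (\<lambda>x y. - ((x - mu phi y) /\<^sub>R sigma2 phi y))"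
    by (rule nll_mean_gradient_residual)
  fix x y
  show "GDERIV (\<lambda>m. nll_sample x m (sigma2 phi y)) (mu phi y) :> - ((x - mu phi y) /\<^sub>R sigma2 phi y)"
    by (rule GDERIV_nll_sample)
  show "grad (\<lambda>m. nll_sample x m (sigma2 phi y)) (mu phi y) =
      grad (\<lambda>m. (norm (x - m))\<^sup>2 / 2) (mu phi y) /\<^sub>R sigma2 phi y"
    by (simp only: grad_nll_sample GDERIV_imp_grad[OF GDERIV_half_norm_square] scaleR_minus_right)
  show "((\<lambda>v. grad (\<lambda>m. nll_sample x m v) (mu phi y)) \<longlongrightarrow> 0) at_top"
    by (rule tendsto_grad_nll_sample)
  show "strict_antimono_on {0<..} (\<lambda>v. norm (grad (\<lambda>m. nll_sample x m v) (mu phi y)))"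
    if "x \<noteq> mu phi y"
    using that by (auto intro!: monotone_onI divide_strict_left_mono simp: norm_grad_nll_sample)
  show "norm (grad (\<lambda>m. nll_sample x' m (sigma2 phi y')) (mu phi y')) <
      norm (grad (\<lambda>m. nll_sample x m (sigma2 phi y)) (mu phi y))"
    if "norm (x - mu phi y) = norm (x' - mu phi y') \<and> x \<noteq> mu phi y \<and>
      sigma2 phi y < sigma2 phi y'" for x' y'
  proof -
    \<comment> \<open>Equal residual norms leave only the variances to compare; \<open>x\<close>
      differing from \<open>mu phi y\<close> makes the common numerator positive, hence
      strictness.\<close>
    have "norm (x - mu phi y) / sigma2 phi y' < norm (x - mu phi y) / sigma2 phi y"
      using that pos by (intro divide_strict_left_mono) auto
    then show ?thesis
      using that by (simp add: norm_grad_nll_sample pos)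
  qed
qed

end
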